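(* Let $L$ be a complete, meet-continuous modular lattice, and $F\prec G$ a covering in $\mathrm{Fil}\,L$ which is atomic or quasi-atomic. If every filter covering $H\prec K$ that is projectively equivalent (in $\mathrm{Fil}\,L$) to $F\prec G$ is principally bounded, then $F\prec G$ is regular in $\mathrm{Fil}\,L$.
   Context: A covering $x\prec y$ in a lattice is a pair $x<y$ with no element strictly between. For pairs with $x\le y$, $z\le w$, write $\langle x,y\rangle\nearrow\langle z,w\rangle$ if $y\wedge z=x$ and $y\vee z=w$; projective equivalence $\sim$ is the symmetric and transitive closure of $\nearrow$. A complete lattice $L$ is meet-continuous if $a\wedge\bigvee D=\bigvee_{d\in D}(a\wedge d)$ for all $a\in L$ and all upward directed $D\subseteq L$. A covering $x\prec y$ in a complete modular lattice is upper regular if for every nonempty chain $I$ and every family of coverings $x_i\prec y_i$ ($i\in I$), each projectively equivalent to $x\prec y$ and such that $i<j$ implies $\langle x_i,y_i\rangle\nearrow\langle x_j,y_j\rangle$, we have $\bigvee_i x_i\prec\bigvee_i y_i$. Lower regular is the dual; regular means both. A filter of $L$ is a nonempty up-closed subset closed under binary meets. $\mathrm{Fil}\,L$ is the lattice of filters ordered by reverse inclusion ($F\le G$ iff $G\subseteq F$), with $F\vee G=F\cap G$; it is complete and modular when $L$ is. For nonempty $S\subseteq L$, $\mathrm{Fg}\,S$ is the smallest filter (under inclusion) containing $S$; filters $\mathrm{Fg}\{x\}$ are principal. A filter covering is a covering in $\mathrm{Fil}\,L$. A maximal based filter is a pair $\langle x,H\rangle$ with $x\in L$, $H\in\mathrm{Fil}\,L$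 and $\mathrm{Fg}\{x\}\prec H$. It is atomic if $H$ is principal. It is quasi-atomic if $H$ is not principal but contains an element $y$ such that $x<z\le y$ implies $z\in H$. A filter covering is atomic (resp. quasi-atomic) if it is projectively equivalent in $\mathrm{Fil}\,L$ to $\mathrm{Fg}\{x\}\prec H$ for some atomic (resp. quasi-atomic) maximal based filter $\langle x,H\rangle$. For $S\subseteq L$, $\mathcal M(S)$ is the set of maximal elements of $S$. For $L$ complete, meet-continuous and modular and $H\prec K$ an atomic or quasi-atomic filter covering, the set $\mathcal M(H-K)$ is nonempty ($H-K$ is set difference), and $H\prec K$ is called principally bounded if the filter $\mathrm{Fg}\,\mathcal M(H-K)$ is principal, equivalently $\bigwedge\mathcal M(H-K)\in\mathrm{Fg}\,\mathcal M(H-K)$. *)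

theory Defs
  imports Main
begin

section \<open>Modular and meet-continuous lattices\<close>

class modular_lattice = lattice +
  assumes modular: "x \<le> z \<Longrightarrow> sup x (inf y z) = inf (sup x y) z"

definition (in order) up_directed :: "'a set \<Rightarrow> bool" where
  "up_directed D \<longleftrightarrow> D \<noteq> {} \<and> (\<forall>x\<in>D. \<forall>y\<in>D. \<exists>z\<in>D. x \<le> z \<and> y \<le> z)"

class meet_continuous_lattice = complete_lattice +
  assumes meet_continuous: "up_directed D \<Longrightarrow> inf a (Sup D) = (SUP d\<in>D. inf a d)"

section \<open>Coverings, projective equivalence and regularity\<close>

definition covered_by :: "'a::order \<Rightarrow> 'a \<Rightarrow> bool" (infix "\<prec>" 50) where
  "x \<prec> y \<longleftrightarrow> x < y \<and> \<not> (\<exists>z. x < z \<and> z < y)"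

definition transposes_up :: "'a::lattice \<times> 'a \<Rightarrow> 'a \<times> 'a \<Rightarrow> bool" (infix "\<nearrow>" 50) where
  "p \<nearrow> q \<longleftrightarrow> fst p \<le> snd p \<and> fst q \<le> snd q \<and>
     inf (snd p) (fst q) = fst p \<and> sup (snd p) (fst q) = snd q"

definition projectively_equivalent :: "'a::lattice \<times> 'a \<Rightarrow> 'a \<times> 'a \<Rightarrow> bool" where
  "projectively_equivalent = (symclp (\<nearrow>))\<^sup>+\<^sup>+"

text \<open>
  The index chains are strict linear orders \<open>r\<close> on sets \<open>I\<close> of pairs. This choice of index
  type loses no generality: see \<open>upper_regularD\<close> and \<open>lower_regularD\<close>, where the index type
  is arbitrary.
\<close>

definition upper_regular :: "'a::complete_lattice \<Rightarrow> 'a \<Rightarrow> bool" where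
  "upper_regular x y \<longleftrightarrow>
     (\<forall>(I :: ('a \<times> 'a) set) r a b.
        I \<noteq> {} \<longrightarrow> strict_linear_order_on I r \<longrightarrow>
        (\<forall>i\<in>I. a i \<prec> b i \<and> projectively_equivalent (a i, b i) (x, y)) \<longrightarrow>
        (\<forall>i\<in>I. \<forall>j\<in>I. (i, j) \<in> r \<longrightarrow> (a i, b i) \<nearrow> (a j, b j)) \<longrightarrow>
        (SUP i\<in>I. a i) \<prec> (SUP i\<in>I. b i))"

text \<open>
  Passing to the dual lattice turns \<open>(u, v) \<nearrow> (z, w)\<close> into \<open>(z, w) \<nearrow> (u, v)\<close>, hence the
  interchange of \<open>i\<close> and \<open>j\<close>.
\<close>

definition lower_regular :: "'a::complete_lattice \<Rightarrow> 'a \<Rightarrow> bool" where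
  "lower_regular x y \<longleftrightarrow>
     (\<forall>(I :: ('a \<times> 'a) set) r a b.
        I \<noteq> {} \<longrightarrow> strict_linear_order_on I r \<longrightarrow>
        (\<forall>i\<in>I. a i \<prec> b i \<and> projectively_equivalent (a i, b i) (x, y)) \<longrightarrow>
        (\<forall>i\<in>I. \<forall>j\<in>I. (i, j) \<in> r \<longrightarrow> (a j, b j) \<nearrow> (a i, b i)) \<longrightarrow>
        (INF i\<in>I. a i) \<prec> (INF i\<in>I. b i))"

definition regular :: "'a::complete_lattice \<Rightarrow> 'a \<Rightarrow> bool" where
  "regular x y \<longleftrightarrow> upper_regular x y \<and> lower_regular x y"

lemma transposes_up_trans:
  assumes "p \<nearrow> q" "q \<nearrow> s"
  shows "p \<nearrow> s"
proof -
  obtain x y z w u v where [simp]: "p = (x, y)" "q = (z, w)" "s = (u, v)"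
    by (cases p, cases q, cases s)
  have h: "x \<le> y" "z \<le> w" "u \<le> v" "inf y z = x" "sup y z = w" "inf w u = z" "sup w u = v"
    using assms by (auto simp: transposes_up_def)
  have "inf y u = inf (inf y w) u"
    using h by (metis inf.absorb1 sup_ge1)
  also have "\<dots> = x"
    using h by (simp add: inf.assoc)
  finally have "inf y u = x" .
  moreover have "sup y u = v"
    using h by (metis inf_le2 sup.absorb2 sup.assoc)
  ultimately show ?thesis
    using h by (simp add: transposes_up_def)
qed

lemma transposes_up_antisym:
  assumes "p \<nearrow> q" "q \<nearrow> p"
  shows "p = q"
proof -
  obtain x y z w where [simp]: "p = (x, y)" "q = (z, w)"
    by (cases p, cases q)
  have h: "inf y z = x" "sup y z = w" "inf w x = z" "sup w x = y"
    using assms by (auto simp: transposes_up_def)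
  then show ?thesis
    by (metis \<open>p = (x, y)\<close> \<open>q = (z, w)\<close> inf.cobounded1 inf.cobounded2 order.antisym sup.cobounded1)
qed

lemma strict_linear_order_transposes_up:
  assumes "\<And>p q. p \<in> C \<Longrightarrow> q \<in> C \<Longrightarrow> p \<noteq> q \<Longrightarrow> p \<nearrow> q \<or> q \<nearrow> p"
  shows "strict_linear_order_on C {(p, q). p \<in> C \<and> q \<in> C \<and> p \<noteq> q \<and> p \<nearrow> q}"
  unfolding strict_linear_order_on_def
proof (intro conjI)
  show "trans {(p, q). p \<in> C \<and> q \<in> C \<and> p \<noteq> q \<and> p \<nearrow> q}"
    by (rule transI) (use transposes_up_trans transposes_up_antisym in blast)
  show "irrefl {(p, q). p \<in> C \<and> q \<in> C \<and> p \<noteq> q \<and> p \<nearrow> q}"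
    by (simp add: irrefl_def)
  show "total_on C {(p, q). p \<in> C \<and> q \<in> C \<and> p \<noteq> q \<and> p \<nearrow> q}"
    using assms by (auto simp: total_on_def)
qed

lemma upper_regularD:
  fixes I :: "'i set" and r :: "('i \<times> 'i) set"
  assumes "upper_regular x y" "I \<noteq> {}" "strict_linear_order_on I r"
    and "\<And>i. i \<in> I \<Longrightarrow> a i \<prec> b i \<and> projectively_equivalent (a i, b i) (x, y)"
    and up: "\<And>i j. i \<in> I \<Longrightarrow> j \<in> I \<Longrightarrow> (i, j) \<in> r \<Longrightarrow> (a i, b i) \<nearrow> (a j, b j)"
  shows "(SUP i\<in>I. a i) \<prec> (SUP i\<in>I. b i)"
proof -
  define C where "C = (\<lambda>i. (a i, b i)) ` I"
  define R where "R = {(p, q). p \<in> C \<and> q \<in> C \<and> p \<noteq> q \<and> p \<nearrow> q}"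
  have "p \<nearrow> q \<or> q \<nearrow> p" if pq: "p \<in> C" "q \<in> C" "p \<noteq> q" for p q
  proof -
    obtain i j where ij: "i \<in> I" "j \<in> I" "p = (a i, b i)" "q = (a j, b j)"
      using pq by (auto simp: C_def)
    then have "(i, j) \<in> r \<or> (j, i) \<in> r"
      using assms(3) pq(3) by (auto simp: strict_linear_order_on_def total_on_def)
    then show ?thesis
      using up ij by blast
  qed
  then have "strict_linear_order_on C R"
    unfolding R_def by (rule strict_linear_order_transposes_up)
  moreover have "C \<noteq> {}"
    using assms(2) by (simp add: C_def)
  moreover have "\<forall>p\<in>C. fst p \<prec> snd p \<and> projectively_equivalent (fst p, snd p) (x, y)"
    using assms(4) by (auto simp: C_def)
  moreover have "\<forall>p\<in>C. \<forall>q\<in>C. (p, q) \<in> R \<longrightarrow> (fst p, snd p) \<nearrow> (fst q, snd q)"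
    by (simp add: R_def)
  ultimately have "(SUP p\<in>C. fst p) \<prec> (SUP p\<in>C. snd p)"
    using assms(1) unfolding upper_regular_def by blast
  then show ?thesis
    by (simp add: C_def image_image)
qed

lemma lower_regularD:
  fixes I :: "'i set" and r :: "('i \<times> 'i) set"
  assumes "lower_regular x y" "I \<noteq> {}" "strict_linear_order_on I r"
    and "\<And>i. i \<in> I \<Longrightarrow> a i \<prec> b i \<and> projectively_equivalent (a i, b i) (x, y)"
    and down: "\<And>i j. i \<in> I \<Longrightarrow> j \<in> I \<Longrightarrow> (i, j) \<in> r \<Longrightarrow> (a j, b j) \<nearrow> (a i, b i)"
  shows "(INF i\<in>I. a i) \<prec> (INF i\<in>I. b i)"
proof -
  define C where "C = (\<lambda>i. (a i, b i)) ` I"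
  define R where "R = {(p, q). p \<in> C \<and> q \<in> C \<and> p \<noteq> q \<and> p \<nearrow> q}"
  have "p \<nearrow> q \<or> q \<nearrow> p" if pq: "p \<in> C" "q \<in> C" "p \<noteq> q" for p q
  proof -
    obtain i j where ij: "i \<in> I" "j \<in> I" "p = (a i, b i)" "q = (a j, b j)"
      using pq by (auto simp: C_def)
    then have "(i, j) \<in> r \<or> (j, i) \<in> r"
      using assms(3) pq(3) by (auto simp: strict_linear_order_on_def total_on_def)
    then show ?thesis
      using down ij by blast
  qed
  then have "strict_linear_order_on C R"
    unfolding R_def by (rule strict_linear_order_transposes_up)
  then have "strict_linear_order_on C (R\<inverse>)"
    by (auto simp: strict_linear_order_on_def irrefl_def)
  moreover have "C \<noteq> {}"
    using assms(2) by (simp add: C_def)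
  moreover have "\<forall>p\<in>C. fst p \<prec> snd p \<and> projectively_equivalent (fst p, snd p) (x, y)"
    using assms(4) by (auto simp: C_def)
  moreover have "\<forall>p\<in>C. \<forall>q\<in>C. (p, q) \<in> R\<inverse> \<longrightarrow> (fst q, snd q) \<nearrow> (fst p, snd p)"
    by (simp add: R_def)
  ultimately have "(INF p\<in>C. fst p) \<prec> (INF p\<in>C. snd p)"
    using assms(1) unfolding lower_regular_def by blast
  then show ?thesis
    by (simp add: C_def image_image)
qed

section \<open>The lattice of filters\<close>

definition is_lattice_filter :: "'a::lattice set \<Rightarrow> bool" where
  "is_lattice_filter F \<longleftrightarrow>
     F \<noteq> {} \<and> (\<forall>x\<in>F. \<forall>y. x \<le> y \<longrightarrow> y \<in> F) \<and> (\<forall>x\<in>F. \<forall>y\<in>F. inf x y \<in> F)"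

text \<open>The improper filter \<open>UNIV\<close> is included; it is the least element.\<close>

typedef (overloaded) 'a Fil = "{F :: 'a::lattice set. is_lattice_filter F}"
  morphisms elems Abs_Fil
proof
  show "UNIV \<in> {F :: 'a set. is_lattice_filter F}"
    by (simp add: is_lattice_filter_def)
qed

lemma is_lattice_filter_elems: "is_lattice_filter (elems F)"
  using elems by blast

lemma top_in_lattice_filter:
  "is_lattice_filter F \<Longrightarrow> (top :: 'a::bounded_lattice) \<in> F"
  unfolding is_lattice_filter_def by (meson ex_in_conv top_greatest)

lemma is_lattice_filter_Inter:
  assumes "\<And>F. F \<in> A \<Longrightarrow> is_lattice_filter (F :: 'a::bounded_lattice set)"
  shows "is_lattice_filter (\<Inter>A)"
proof -
  have "top \<in> \<Inter>A"
    using assms top_in_lattice_filter by blast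
  then show ?thesis
    using assms unfolding is_lattice_filter_def by blast
qed

text \<open>
  The set \<open>S\<close> is meant to be nonempty; by convention \<open>Fg {}\<close> is \<open>{top}\<close>.
\<close>

definition Fg :: "'a::bounded_lattice set \<Rightarrow> 'a Fil" where
  "Fg S = Abs_Fil (\<Inter>{F. is_lattice_filter F \<and> S \<subseteq> F})"

lemma elems_Fg: "elems (Fg S) = \<Inter>{F. is_lattice_filter F \<and> S \<subseteq> F}"
proof -
  have "is_lattice_filter (\<Inter>{F. is_lattice_filter F \<and> S \<subseteq> F})"
    by (rule is_lattice_filter_Inter) simp
  then show ?thesis
    by (simp add: Fg_def Abs_Fil_inverse)
qed

lemma Fg_subset_iff: "elems (Fg S) \<subseteq> elems F \<longleftrightarrow> S \<subseteq> elems F"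
  using is_lattice_filter_elems[of F] by (auto simp: elems_Fg)

text \<open>Filters are ordered by reverse inclusion.\<close>

instantiation Fil :: (bounded_lattice) complete_lattice
begin

definition less_eq_Fil :: "'a Fil \<Rightarrow> 'a Fil \<Rightarrow> bool" where
  "F \<le> G \<longleftrightarrow> elems G \<subseteq> elems F"

definition less_Fil :: "'a Fil \<Rightarrow> 'a Fil \<Rightarrow> bool" where
  "F < G \<longleftrightarrow> elems G \<subset> elems F"

definition sup_Fil :: "'a Fil \<Rightarrow> 'a Fil \<Rightarrow> 'a Fil" where
  "sup F G = Abs_Fil (elems F \<inter> elems G)"

definition inf_Fil :: "'a Fil \<Rightarrow> 'a Fil \<Rightarrow> 'a Fil" where
  "inf F G = Fg (elems F \<union> elems G)"

definition Sup_Fil :: "'a Fil set \<Rightarrow> 'a Fil" where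
  "Sup A = Abs_Fil (\<Inter>F\<in>A. elems F)"

definition Inf_Fil :: "'a Fil set \<Rightarrow> 'a Fil" where
  "Inf A = Fg (\<Union>F\<in>A. elems F)"

definition top_Fil :: "'a Fil" where
  "top = Fg {top}"

definition bot_Fil :: "'a Fil" where
  "bot = Fg UNIV"

lemma elems_sup: "elems (sup F G :: 'a Fil) = elems F \<inter> elems G"
  unfolding sup_Fil_def
  using is_lattice_filter_Inter[of "{elems F, elems G}"] is_lattice_filter_elems
  by (intro Abs_Fil_inverse) auto

lemma elems_Sup: "elems (Sup A :: 'a Fil) = (\<Inter>F\<in>A. elems F)"
  unfolding Sup_Fil_def
  using is_lattice_filter_Inter[of "elems ` A"] is_lattice_filter_elems
  by (intro Abs_Fil_inverse) auto

instance
proof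
  fix F G H :: "'a Fil" and A :: "'a Fil set"
  show "F < G \<longleftrightarrow> F \<le> G \<and> \<not> G \<le> F"
    by (auto simp: less_eq_Fil_def less_Fil_def)
  show "F \<le> F"
    by (simp add: less_eq_Fil_def)
  show "F \<le> G \<Longrightarrow> G \<le> H \<Longrightarrow> F \<le> H"
    by (auto simp: less_eq_Fil_def)
  show "F \<le> G \<Longrightarrow> G \<le> F \<Longrightarrow> F = G"
    by (simp add: less_eq_Fil_def elems_inject[symmetric])
  show "inf F G \<le> F" "inf F G \<le> G"
    using Fg_subset_iff[of "elems F \<union> elems G" "inf F G"]
    by (auto simp: less_eq_Fil_def inf_Fil_def)
  show "F \<le> G \<Longrightarrow> F \<le> H \<Longrightarrow> F \<le> inf G H"
    by (simp add: less_eq_Fil_def inf_Fil_def Fg_subset_iff)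
  show "F \<le> sup F G" "G \<le> sup F G"
    by (auto simp: less_eq_Fil_def elems_sup)
  show "G \<le> F \<Longrightarrow> H \<le> F \<Longrightarrow> sup G H \<le> F"
    by (simp add: less_eq_Fil_def elems_sup)
  show "Inf A \<le> F" if "F \<in> A"
    using that Fg_subset_iff[of "\<Union>F\<in>A. elems F" "Inf A"]
    by (auto simp: less_eq_Fil_def Inf_Fil_def)
  show "F \<le> Inf A" if "\<And>G. G \<in> A \<Longrightarrow> F \<le> G"
    using that by (auto simp: less_eq_Fil_def Inf_Fil_def Fg_subset_iff UN_subset_iff)
  show "F \<le> Sup A" if "F \<in> A"
    using that by (auto simp: less_eq_Fil_def elems_Sup)
  show "Sup A \<le> F" if "\<And>G. G \<in> A \<Longrightarrow> G \<le> F"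
    using that by (auto simp: less_eq_Fil_def elems_Sup)
  show "Inf {} = (top :: 'a Fil)"
  proof -
    have "{F :: 'a set. is_lattice_filter F \<and> {} \<subseteq> F} = {F. is_lattice_filter F \<and> {top} \<subseteq> F}"
      using top_in_lattice_filter by blast
    then show ?thesis
      by (simp add: Inf_Fil_def top_Fil_def Fg_def)
  qed
  show "Sup {} = (bot :: 'a Fil)"
    by (auto simp: elems_inject[symmetric] elems_Sup bot_Fil_def elems_Fg)
qed

end

section \<open>Atomic, quasi-atomic and principally bounded filter coverings\<close>

definition principal_filter :: "'a::bounded_lattice Fil \<Rightarrow> bool" where
  "principal_filter H \<longleftrightarrow> (\<exists>x. H = Fg {x})"

definition maximal_based_filter :: "'a::bounded_lattice \<Rightarrow> 'a Fil \<Rightarrow> bool" where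
  "maximal_based_filter x H \<longleftrightarrow> Fg {x} \<prec> H"

definition atomic_based_filter :: "'a::bounded_lattice \<Rightarrow> 'a Fil \<Rightarrow> bool" where
  "atomic_based_filter x H \<longleftrightarrow> maximal_based_filter x H \<and> principal_filter H"

definition quasi_atomic_based_filter :: "'a::bounded_lattice \<Rightarrow> 'a Fil \<Rightarrow> bool" where
  "quasi_atomic_based_filter x H \<longleftrightarrow>
     maximal_based_filter x H \<and> \<not> principal_filter H \<and>
     (\<exists>y\<in>elems H. \<forall>z. x < z \<and> z \<le> y \<longrightarrow> z \<in> elems H)"

definition atomic_covering :: "'a::bounded_lattice Fil \<Rightarrow> 'a Fil \<Rightarrow> bool" where
  "atomic_covering F G \<longleftrightarrow> F \<prec> G \<and>
     (\<exists>x H. atomic_based_filter x H \<and> projectively_equivalent (F, G) (Fg {x}, H))"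

definition quasi_atomic_covering :: "'a::bounded_lattice Fil \<Rightarrow> 'a Fil \<Rightarrow> bool" where
  "quasi_atomic_covering F G \<longleftrightarrow> F \<prec> G \<and>
     (\<exists>x H. quasi_atomic_based_filter x H \<and> projectively_equivalent (F, G) (Fg {x}, H))"

definition maximal_elements :: "'a::order set \<Rightarrow> 'a set" where
  "maximal_elements S = {x \<in> S. \<not> (\<exists>y\<in>S. x < y)}"

definition principally_bounded :: "'a::bounded_lattice Fil \<Rightarrow> 'a Fil \<Rightarrow> bool" where
  "principally_bounded H K \<longleftrightarrow> principal_filter (Fg (maximal_elements (elems H - elems K)))"

end

(*
  Lower regularity holds for every filter covering, because Fil L is join-continuous. For upper
  regularity, call F \<prec> G tame if above each d in F - G there is y in G such that every z with
  d < z \<le> y lies in G. Tameness is invariant under projective equivalence and holds for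
  atomic and quasi-atomic based filters. By meet-continuity it makes F - G closed under directed
  joins, since such a join s of elements above d satisfies inf s y = d. Given a rising chain of
  coverings (F_i, G_i), the sets F_i - G_i and their sets of maximal elements decrease, so the
  meets p_i of the latter increase; principal boundedness puts p_i into F_i - G_i. The join of the
  p_i then belongs to every F_i but not to every G_i, so the join of the F_i differs from
  that of the G_i; hence (F_i, G_i) transposes up to the pair of joins, which is again a covering.
*)

theory Submission
  imports Defs
begin

section \<open>Coverings in modular lattices\<close>

text \<open>By modularity an element \<open>u\<close> between \<open>z\<close> and \<open>w\<close>
  is recovered as \<open>sup z (inf y u)\<close>, and \<open>inf y u\<close> can only be
  \<open>x\<close> or \<open>y\<close>.\<close>

lemma transposes_up_covered_byD:
  fixes x y z w :: "'a::modular_lattice"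
  assumes "(x, y) \<nearrow> (z, w)" "x \<prec> y"
  shows "z \<prec> w"
proof -
  have h: "inf y z = x" "sup y z = w"
    using assms(1) by (auto simp: transposes_up_def)
  have "z \<noteq> w"
    using h assms(2) unfolding covered_by_def
    by (metis inf.absorb1 order.strict_iff_order sup_ge1)
  then have "z < w"
    using h by (metis sup_ge2 order.not_eq_order_implies_strict)
  moreover have False if u: "z < u" "u < w" for u
  proof -
    have "x \<le> inf y u" "inf y u \<le> y"
      using h u by (auto intro: le_infI2)
    then have "inf y u = x \<or> inf y u = y"
      using assms(2) unfolding covered_by_def by (metis order.not_eq_order_implies_strict)
    moreover have "sup z (inf y u) = u"
      using modular[of z u y] h u by (simp add: sup.commute inf.absorb2)
    ultimately have "u = sup z x \<or> u = sup z y"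
      by metis
    then show False
      using h u by (auto simp: sup.commute sup.absorb1)
  qed
  ultimately show ?thesis
    by (auto simp: covered_by_def)
qed

text \<open>Dually, \<open>u\<close> between \<open>x\<close> and \<open>y\<close> is recovered as
  \<open>inf (sup u z) y\<close>, and \<open>sup u z\<close> can only be \<open>z\<close> or
  \<open>w\<close>.\<close>

lemma covered_by_transposes_upD:
  fixes x y z w :: "'a::modular_lattice"
  assumes "(x, y) \<nearrow> (z, w)" "z \<prec> w"
  shows "x \<prec> y"
proof -
  have h: "inf y z = x" "sup y z = w"
    using assms(1) by (auto simp: transposes_up_def)
  have "x \<noteq> y"
    using h assms(2) by (auto simp: covered_by_def inf.absorb_iff1 sup.absorb2)
  then have "x < y"
    using h by (metis inf_le1 order.not_eq_order_implies_strict)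
  moreover have False if u: "x < u" "u < y" for u
  proof -
    have "z \<le> sup u z" "sup u z \<le> w"
      using h u by (auto intro: le_supI1)
    then have "sup u z = z \<or> sup u z = w"
      using assms(2) unfolding covered_by_def by (metis order.not_eq_order_implies_strict)
    moreover have "inf (sup u z) y = u"
      using modular[of u y z] h u by (simp add: inf.commute sup.absorb1)
    ultimately have "u = inf z y \<or> u = inf w y"
      by metis
    then show False
      using h u by (auto simp: inf.commute inf.absorb1)
  qed
  ultimately show ?thesis
    by (auto simp: covered_by_def)
qed

section \<open>Elements of filters\<close>

lemma elems_upward: "x \<in> elems F \<Longrightarrow> x \<le> y \<Longrightarrow> y \<in> elems F"
  using is_lattice_filter_elems[of F] by (auto simp: is_lattice_filter_def)

lemma elems_inf_closed: "x \<in> elems F \<Longrightarrow> y \<in> elems F \<Longrightarrow> inf x y \<in> elems F"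
  using is_lattice_filter_elems[of F] by (auto simp: is_lattice_filter_def)

lemma elems_nonempty: "\<exists>x. x \<in> elems F"
  using is_lattice_filter_elems[of F] by (auto simp: is_lattice_filter_def)

lemma subset_elems_Fg: "S \<subseteq> elems (Fg S)"
  by (auto simp: elems_Fg)

lemma elems_Fg_singleton: "elems (Fg {x :: 'a::bounded_lattice}) = {x..}"
proof
  have "is_lattice_filter {x..}"
    by (auto simp: is_lattice_filter_def intro: order_trans)
  then show "elems (Fg {x}) \<subseteq> {x..}"
    by (auto simp: elems_Fg)
  show "{x..} \<subseteq> elems (Fg {x})"
    using subset_elems_Fg[of "{x}"] by (auto intro: elems_upward)
qed

text \<open>Regrouping meets shows that the right-hand side is already a filter, so it is the one
  generated by the union.\<close>

lemma elems_inf: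
  fixes F G :: "'a::bounded_lattice Fil"
  shows "elems (inf F G) = {z. \<exists>f\<in>elems F. \<exists>g\<in>elems G. inf f g \<le> z}" (is "_ = ?S")
proof
  have "is_lattice_filter ?S"
    unfolding is_lattice_filter_def
  proof (intro conjI ballI allI impI)
    show "?S \<noteq> {}"
      using elems_nonempty[of F] elems_nonempty[of G] by blast
  next
    fix u v assume "u \<in> ?S" "u \<le> v"
    then show "v \<in> ?S"
      by (auto intro: order_trans)
  next
    fix u v assume "u \<in> ?S" "v \<in> ?S"
    then obtain f g f' g' where fg: "f \<in> elems F" "g \<in> elems G" "inf f g \<le> u"
      "f' \<in> elems F" "g' \<in> elems G" "inf f' g' \<le> v"
      by blast
    have "inf (inf f f') (inf g g') = inf (inf f g) (inf f' g')"
      by (simp add: inf.assoc inf.left_commute)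
    also have "\<dots> \<le> inf u v"
      using fg by (blast intro: inf_mono)
    finally show "inf u v \<in> ?S"
      using fg elems_inf_closed by blast
  qed
  moreover have "elems F \<union> elems G \<subseteq> ?S"
    using elems_nonempty[of F] elems_nonempty[of G] by (auto intro: le_infI1 le_infI2)
  ultimately show "elems (inf F G) \<subseteq> ?S"
    using Fg_subset_iff[of _ "Abs_Fil ?S"] by (simp add: inf_Fil_def Abs_Fil_inverse)
  have "elems F \<subseteq> elems (inf F G)" "elems G \<subseteq> elems (inf F G)"
    using inf_le1[of F G] inf_le2[of F G] by (simp_all add: less_eq_Fil_def)
  then show "?S \<subseteq> elems (inf F G)"
    using elems_inf_closed[of _ "inf F G"] elems_upward[of _ "inf F G"] by blast
qed

instance Fil :: ("{bounded_lattice, modular_lattice}") modular_lattice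
proof
  fix X Y Z :: "'a Fil"
  assume "X \<le> Z"
  show "sup X (inf Y Z) = inf (sup X Y) Z"
  proof (rule order.antisym)
    show "sup X (inf Y Z) \<le> inf (sup X Y) Z"
      using \<open>X \<le> Z\<close> by (auto intro: le_infI1)
    show "inf (sup X Y) Z \<le> sup X (inf Y Z)"
      unfolding less_eq_Fil_def
    proof
      fix e assume "e \<in> elems (sup X (inf Y Z))"
      then obtain y z where e: "e \<in> elems X" "y \<in> elems Y" "z \<in> elems Z" "inf y z \<le> e"
        by (auto simp: elems_sup elems_inf)
      \<comment> \<open>\<open>y'\<close> enlarges \<open>y\<close> so that it also lies in
        \<open>X\<close>: from \<open>X \<le> Z\<close> the element \<open>z\<close>, hence
        \<open>inf e z\<close>, is in \<open>X\<close>. Modularity in the base lattice keeps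
        \<open>inf y' z\<close> below \<open>e\<close>.\<close>
      define y' where "y' = sup (inf e z) y"
      have "z \<in> elems X"
        using \<open>X \<le> Z\<close> e by (auto simp: less_eq_Fil_def)
      then have "y' \<in> elems (sup X Y)"
        using e elems_inf_closed elems_upward unfolding y'_def elems_sup
        by (metis IntI sup_ge1 sup_ge2)
      moreover have "inf y' z = sup (inf e z) (inf y z)"
        using modular[of "inf e z" z y] by (simp add: y'_def)
      then have "inf y' z \<le> e"
        using e by (auto intro: le_infI1)
      ultimately show "e \<in> elems (inf (sup X Y) Z)"
        using e by (auto simp: elems_inf)
    qed
  qed
qed

lemma transposes_up_elems:
  assumes "(F, G) \<nearrow> (F', G')"
  shows "elems G \<subseteq> elems F" "elems F' \<subseteq> elems F" "elems G' = elems G \<inter> elems F'"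
    "F = inf G F'"
proof -
  have h: "F \<le> G" "inf G F' = F" "sup G F' = G'"
    using assms by (auto simp: transposes_up_def)
  then have "F \<le> F'"
    by (metis inf_le2)
  then show "elems G \<subseteq> elems F" "elems F' \<subseteq> elems F" "elems G' = elems G \<inter> elems F'"
    "F = inf G F'"
    using h by (auto simp: less_eq_Fil_def elems_sup[symmetric])
qed

text \<open>This is how principal boundedness gets used: a generator of \<open>Fg M\<close> is a
  lower bound of \<open>M\<close>, hence lies below \<open>Inf M\<close> and pulls it into
  \<open>Fg M\<close>.\<close>

lemma Inf_mem_of_principal_Fg:
  fixes M :: "'a::complete_lattice set"
  assumes "principal_filter (Fg M)" "M \<subseteq> elems F"
  shows "Inf M \<in> elems F"
proof -
  obtain x where x: "Fg M = Fg {x}"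
    using assms(1) by (auto simp: principal_filter_def)
  have "M \<subseteq> {x..}"
    using subset_elems_Fg[of M] by (simp add: x elems_Fg_singleton)
  then have "x \<le> Inf M"
    by (auto intro: Inf_greatest)
  then have "Inf M \<in> elems (Fg M)"
    by (simp add: x elems_Fg_singleton)
  then show ?thesis
    using assms(2) Fg_subset_iff by blast
qed

section \<open>Tame pairs of filters\<close>

text \<open>The quasi-atomicity condition with base \<open>d\<close>. Elements of \<open>G\<close>
  may fail to lie above \<open>d\<close>, hence the clause \<open>d \<le> y\<close>.\<close>

definition tame_at :: "'a::bounded_lattice Fil \<Rightarrow> 'a \<Rightarrow> bool" where
  "tame_at G d \<longleftrightarrow> (\<exists>y\<in>elems G. d \<le> y \<and> (\<forall>z. d < z \<and> z \<le> y \<longrightarrow> z \<in> elems G))"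

definition tame :: "'a::bounded_lattice Fil \<times> 'a Fil \<Rightarrow> bool" where
  "tame p \<longleftrightarrow> (\<forall>d\<in>elems (fst p) - elems (snd p). tame_at (snd p) d)"

text \<open>Joining with \<open>d\<close> moves the witness \<open>y\<close> to
  \<open>sup d y\<close>. By modularity each \<open>z\<close> in the new interval is
  \<open>sup d (inf y z)\<close>, and \<open>inf y z = c\<close> would give
  \<open>z = d\<close>.\<close>

lemma tame_at_mono:
  fixes c d :: "'a::{bounded_lattice, modular_lattice}"
  assumes "tame_at G c" "c \<le> d"
  shows "tame_at G d"
proof -
  obtain y where y: "y \<in> elems G" "c \<le> y" and up: "\<And>z. c < z \<Longrightarrow> z \<le> y \<Longrightarrow> z \<in> elems G"
    using assms(1) by (auto simp: tame_at_def)
  have "z \<in> elems G" if z: "d < z" "z \<le> sup d y" for z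
  proof -
    have eq: "sup d (inf y z) = z"
      using modular[of d z y] z by (simp add: inf.absorb2)
    then have "inf y z \<noteq> c"
      using assms(2) z by (auto simp: sup.absorb1)
    moreover have "c \<le> inf y z"
      using y assms(2) z by auto
    ultimately have "inf y z \<in> elems G"
      using up by (simp add: order.not_eq_order_implies_strict)
    then show ?thesis
      by (rule elems_upward) simp
  qed
  moreover have "sup d y \<in> elems G"
    using y(1) by (rule elems_upward) simp
  ultimately show ?thesis
    unfolding tame_at_def by (intro bexI[of _ "sup d y"]) auto
qed

text \<open>The witness \<open>y\<close> for \<open>(F, G)\<close> survives: everything above
  \<open>d\<close> is in \<open>F'\<close>, and there \<open>G\<close> and \<open>G'\<close>
  agree.\<close>

lemma tame_transposes_up:
  assumes "(F, G) \<nearrow> (F', G')" "tame (F, G)"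
  shows "tame (F', G')"
  unfolding tame_def
proof
  fix d assume "d \<in> elems (fst (F', G')) - elems (snd (F', G'))"
  then have d: "d \<in> elems F'" "d \<in> elems F - elems G"
    using transposes_up_elems[OF assms(1)] by auto
  then have "tame_at G d"
    using assms(2) by (auto simp: tame_def)
  then show "tame_at (snd (F', G')) d"
    using d(1) transposes_up_elems(3)[OF assms(1)] unfolding tame_at_def
    by (auto 4 4 intro: elems_upward less_imp_le)
qed

text \<open>Tameness is taken at some \<open>f\<close> in \<open>F'\<close>, moved to
  \<open>inf g f\<close> below \<open>d\<close> for a suitable \<open>g\<close> in \<open>G\<close>,
  then raised to \<open>d\<close> by \<open>tame_at_mono\<close>.\<close>

lemma tame_transposes_down:
  fixes F G F' G' :: "'a::{bounded_lattice, modular_lattice} Fil"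
  assumes "(F, G) \<nearrow> (F', G')" "tame (F', G')"
  shows "tame (F, G)"
  unfolding tame_def
proof
  fix d assume "d \<in> elems (fst (F, G)) - elems (snd (F, G))"
  then have d: "d \<in> elems F" "d \<notin> elems G"
    by auto
  note tr = transposes_up_elems[OF assms(1)]
  obtain g0 f where f: "g0 \<in> elems G" "f \<in> elems F'" "inf g0 f \<le> d"
    using d(1) tr(4) by (auto simp: elems_inf)
  have "f \<notin> elems G"
    using f d elems_inf_closed elems_upward by blast
  then have "tame_at G' f"
    using assms(2) f tr(3) by (auto simp: tame_def)
  then obtain y where y: "y \<in> elems G" "f \<le> y"
    and up: "\<And>z. f < z \<Longrightarrow> z \<le> y \<Longrightarrow> z \<in> elems G"
    using tr(3) by (auto simp: tame_at_def)
  \<comment> \<open>Cutting \<open>g0\<close> down by \<open>y\<close> ensures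
    \<open>sup z f \<le> y\<close> for all \<open>z \<le> g\<close>, so that tameness at
    \<open>f\<close> applies to \<open>sup z f\<close>; meeting with \<open>g\<close> then returns
    \<open>z\<close>.\<close>
  define g where "g = inf g0 y"
  have g: "g \<in> elems G" "g \<le> y" "inf g f \<le> d"
    using f y elems_inf_closed by (auto simp: g_def inf.assoc inf.absorb2)
  have "z \<in> elems G" if z: "inf g f < z" "z \<le> g" for z
  proof -
    have "\<not> z \<le> f"
      using z by (metis le_inf_iff less_le_not_le)
    then have "f < sup z f"
      by (metis sup_ge1 sup_ge2 order.not_eq_order_implies_strict)
    then have "sup z f \<in> elems G"
      using up z g y by (meson le_supI order_trans)
    then have "inf (sup z f) g \<in> elems G"
      using g elems_inf_closed by blast
    moreover have "inf (sup z f) g = z"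
      using modular[of z g f] z by (simp add: sup.absorb1 inf.commute)
    ultimately show ?thesis
      by simp
  qed
  then have "tame_at G (inf g f)"
    using g(1) unfolding tame_at_def by (intro bexI[of _ g]) auto
  then show "tame_at (snd (F, G)) d"
    using tame_at_mono g(3) by auto
qed

lemma tame_projectively_equivalent:
  fixes p q :: "'a::{bounded_lattice, modular_lattice} Fil \<times> 'a Fil"
  assumes "projectively_equivalent p q"
  shows "tame p \<longleftrightarrow> tame q"
proof -
  have step: "tame p \<longleftrightarrow> tame q" if "symclp (\<nearrow>) p q" for p q :: "'a Fil \<times> 'a Fil"
    using that tame_transposes_up tame_transposes_down
    by (cases p; cases q) (auto elim!: symclpE)
  show ?thesis
    using assms unfolding projectively_equivalent_def
    by (induction rule: tranclp_induct) (use step in blast)+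
qed

text \<open>All elements of \<open>Fg {x}\<close> lie above \<open>x\<close>, so
  \<open>tame_at_mono\<close> spreads the property from the base.\<close>

lemma tame_principalI:
  fixes x :: "'a::{bounded_lattice, modular_lattice}"
  assumes "tame_at H x"
  shows "tame (Fg {x}, H)"
  using assms tame_at_mono by (auto simp: tame_def elems_Fg_singleton)

lemma tame_atomic:
  fixes x :: "'a::{bounded_lattice, modular_lattice}"
  assumes "atomic_based_filter x H"
  shows "tame (Fg {x}, H)"
proof -
  obtain y where y: "H = Fg {y}" and cov: "Fg {x} \<prec> Fg {y}"
    using assms by (auto simp: atomic_based_filter_def maximal_based_filter_def principal_filter_def)
  \<comment> \<open>Principal filters embed the base lattice in order, so the filter covering yields
    a covering of \<open>x\<close> by \<open>y\<close>, and the generator \<open>y\<close> is the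
    witness.\<close>
  have le: "Fg {u} \<le> Fg {v} \<longleftrightarrow> u \<le> v" for u v :: 'a
    by (auto simp: less_eq_Fil_def elems_Fg_singleton)
  then have lt: "Fg {u} < Fg {v} \<longleftrightarrow> u < v" for u v :: 'a
    by (simp add: less_le_not_le)
  have "x < y" "\<not> (x < z \<and> z < y)" for z
    using cov lt unfolding covered_by_def by blast+
  then have "tame_at H x"
    unfolding tame_at_def y elems_Fg_singleton
    by (intro bexI[of _ y]) (auto simp: order.order_iff_strict)
  then show ?thesis
    by (rule tame_principalI)
qed

lemma tame_quasi_atomic:
  fixes x :: "'a::{bounded_lattice, modular_lattice}"
  assumes "quasi_atomic_based_filter x H"
  shows "tame (Fg {x}, H)"
proof -
  have "elems H \<subseteq> {x..}"
    using assms unfolding quasi_atomic_based_filter_def maximal_based_filter_def covered_by_def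
    by (auto simp: less_Fil_def elems_Fg_singleton)
  then have "tame_at H x"
    using assms unfolding quasi_atomic_based_filter_def tame_at_def by fastforce
  then show ?thesis
    by (rule tame_principalI)
qed

lemma tame_atomic_or_quasi_atomic:
  fixes F G :: "'a::{bounded_lattice, modular_lattice} Fil"
  assumes "atomic_covering F G \<or> quasi_atomic_covering F G"
  shows "tame (F, G)"
  using assms tame_atomic tame_quasi_atomic tame_projectively_equivalent
  unfolding atomic_covering_def quasi_atomic_covering_def by blast

text \<open>Fix \<open>d\<close> in \<open>D\<close> with its witness \<open>y\<close>. Each
  \<open>inf y e\<close> stays below \<open>d\<close>, so meet-continuity gives
  \<open>inf y (Sup D) \<le> d\<close>; with \<open>Sup D\<close> in \<open>G\<close>, also
  \<open>d\<close> would be in \<open>G\<close>.\<close>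

lemma tame_Sup_notin:
  fixes F G :: "'a::meet_continuous_lattice Fil"
  assumes "tame (F, G)" and D: "up_directed D" "D \<subseteq> elems F - elems G"
  shows "Sup D \<notin> elems G"
proof
  assume sup: "Sup D \<in> elems G"
  obtain d where d: "d \<in> D"
    using D(1) by (auto simp: up_directed_def)
  then obtain y where y: "y \<in> elems G" "d \<le> y"
    and up: "\<And>z. d < z \<Longrightarrow> z \<le> y \<Longrightarrow> z \<in> elems G"
    using assms(1) D(2) unfolding tame_def tame_at_def fst_conv snd_conv by blast
  have "inf y e \<le> d" if e: "e \<in> D" for e
  proof -
    obtain e' where e': "e' \<in> D" "d \<le> e'" "e \<le> e'"
      using D(1) d e by (auto simp: up_directed_def)
    \<comment> \<open>Passing to \<open>e'\<close> above \<open>d\<close> places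
      \<open>inf y e'\<close> between \<open>d\<close> and \<open>y\<close>; being outside
      \<open>G\<close>, it must be \<open>d\<close>.\<close>
    then have "inf y e' \<notin> elems G"
      using D(2) elems_upward[of "inf y e'" G e'] by auto
    then have "inf y e' = d"
      using up[of "inf y e'"] y e' by (metis inf_le1 le_inf_iff order.not_eq_order_implies_strict)
    then show ?thesis
      using e' by (metis inf_mono order_refl)
  qed
  then have "(SUP e\<in>D. inf y e) \<le> d"
    by (rule SUP_least)
  then have "inf y (Sup D) \<le> d"
    using meet_continuous[OF D(1)] by metis
  then have "d \<in> elems G"
    using sup y(1) elems_inf_closed elems_upward by blast
  then show False
    using d D(2) by blast
qed

lemma tame_maximal_elements_nonempty:
  fixes F G :: "'a::meet_continuous_lattice Fil"
  assumes "tame (F, G)" "F < G"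
  shows "maximal_elements (elems F - elems G) \<noteq> {}"
proof -
  let ?A = "elems F - elems G"
  have ne: "?A \<noteq> {}"
    using assms(2) by (auto simp: less_Fil_def)
  have "\<exists>m\<in>?A. \<forall>a\<in>?A. m \<le> a \<longrightarrow> a = m"
  proof (rule predicate_Zorn)
    show "partial_order_on ?A (relation_of (\<le>) ?A)"
      by (rule partial_order_on_relation_ofI) auto
  next
    fix C assume C: "C \<in> Chains (relation_of (\<le>) ?A)"
    show "\<exists>u\<in>?A. \<forall>a\<in>C. a \<le> u"
    proof (cases "C = {}")
      \<comment> \<open>The empty chain is separate: it is not directed, and its join
        \<open>bot\<close> may lie outside \<open>F\<close>.\<close>
      case True
      then show ?thesis
        using ne by blast
    next
      case False
      have lin: "\<And>a b. a \<in> C \<Longrightarrow> b \<in> C \<Longrightarrow> a \<le> b \<or> b \<le> a"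
        and sub: "C \<subseteq> ?A"
        using C by (auto simp: Chains_def relation_of_def)
      have "up_directed C"
        using False lin unfolding up_directed_def by blast
      then have "Sup C \<notin> elems G"
        using assms(1) sub tame_Sup_notin by blast
      moreover have "Sup C \<in> elems F"
        using False sub by (meson DiffD1 Sup_upper elems_upward ex_in_conv subsetD)
      ultimately show ?thesis
        by (auto intro: Sup_upper)
    qed
  qed
  then show ?thesis
    unfolding maximal_elements_def by (auto simp: less_le)
qed

section \<open>Regularity\<close>

text \<open>The meet of a chain of filters is their union, which makes the pair of meets transpose
  up to each \<open>(a i, b i)\<close>; the covering then passes down.\<close>

lemma lower_regular_Fil:
  fixes F G :: "'a::{bounded_lattice, modular_lattice} Fil"
  shows "lower_regular F G"
  unfolding lower_regular_def
proof (intro allI impI)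
  fix I :: "('a Fil \<times> 'a Fil) set" and r and a b :: "'a Fil \<times> 'a Fil \<Rightarrow> 'a Fil"
  assume ne: "I \<noteq> {}" and lin: "strict_linear_order_on I r"
    and cov: "\<forall>i\<in>I. a i \<prec> b i \<and> projectively_equivalent (a i, b i) (F, G)"
    and down: "\<forall>i\<in>I. \<forall>j\<in>I. (i, j) \<in> r \<longrightarrow> (a j, b j) \<nearrow> (a i, b i)"
  have cmp: "i = j \<or> (a i, b i) \<nearrow> (a j, b j) \<or> (a j, b j) \<nearrow> (a i, b i)"
    if "i \<in> I" "j \<in> I" for i j
    using lin down that unfolding strict_linear_order_on_def total_on_def by blast
  obtain i where i: "i \<in> I"
    using ne by blast
  let ?a = "INF i\<in>I. a i" and ?b = "INF i\<in>I. b i"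
  have leab: "a j \<le> b j" if "j \<in> I" for j
    using cov that by (auto simp: covered_by_def)
  have "sup ?b (a i) = b i"
  proof (rule order.antisym)
    show "sup ?b (a i) \<le> b i"
      using i leab by (auto intro: INF_lower)
    have "is_lattice_filter (\<Union>j\<in>I. elems (b j))"
      unfolding is_lattice_filter_def
    proof (intro conjI ballI allI impI)
      show "(\<Union>j\<in>I. elems (b j)) \<noteq> {}"
        using i elems_nonempty by blast
    next
      fix u v assume "u \<in> (\<Union>j\<in>I. elems (b j))" "u \<le> v"
      then show "v \<in> (\<Union>j\<in>I. elems (b j))"
        using elems_upward by blast
    next
      fix u v assume "u \<in> (\<Union>j\<in>I. elems (b j))" "v \<in> (\<Union>j\<in>I. elems (b j))"
      then obtain j k where jk: "j \<in> I" "k \<in> I" "u \<in> elems (b j)" "v \<in> elems (b k)"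
        by blast
      then have "elems (b j) \<subseteq> elems (b k) \<or> elems (b k) \<subseteq> elems (b j)"
        using cmp[of j k] transposes_up_elems(3) by blast
      then show "inf u v \<in> (\<Union>j\<in>I. elems (b j))"
        using jk elems_inf_closed by blast
    qed
    then have "elems ?b \<subseteq> (\<Union>j\<in>I. elems (b j))"
      using Fg_subset_iff[of _ "Abs_Fil (\<Union>j\<in>I. elems (b j))"]
      by (simp add: Inf_Fil_def Abs_Fil_inverse)
    \<comment> \<open>If \<open>(a i, b i)\<close> is the lower pair, \<open>b j\<close> is a subset
      of \<open>b i\<close>; if it is the upper one, \<open>b i\<close> equals this
      intersection.\<close>
    moreover have "elems (b j) \<inter> elems (a i) \<subseteq> elems (b i)" if "j \<in> I" for j
      using cmp[OF i that] transposes_up_elems(3) by blast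
    ultimately show "b i \<le> sup ?b (a i)"
      unfolding less_eq_Fil_def elems_sup by blast
  qed
  moreover have "inf ?b (a i) = ?a"
  proof (rule order.antisym)
    show "inf ?b (a i) \<le> ?a"
    proof (rule INF_greatest)
      fix j assume j: "j \<in> I"
      have bj: "?b \<le> b j"
        using j by (rule INF_lower)
      have "a i \<le> a j \<or> inf (b j) (a i) = a j"
        using cmp[OF i j] transposes_up_elems(2)[of "a i" "b i" "a j" "b j"]
        by (auto simp: transposes_up_def less_eq_Fil_def)
      then show "inf ?b (a i) \<le> a j"
        using bj by (metis inf_mono le_infI2 order_refl)
    qed
    show "?a \<le> inf ?b (a i)"
      using i leab by (intro le_infI INF_mono INF_lower) auto
  qed
  ultimately have "(?a, ?b) \<nearrow> (a i, b i)"
    using leab[OF i] unfolding transposes_up_def by (simp; metis inf_le1)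
  then show "?a \<prec> ?b"
    using covered_by_transposes_upD cov i by blast
qed

text \<open>\<open>F' - G'\<close> is an up-closed part of \<open>F - G\<close>, because everything
  above an element of \<open>F'\<close> is in \<open>F'\<close>.\<close>

lemma maximal_elements_transposes_up:
  assumes "(F, G) \<nearrow> (F', G')"
  shows "maximal_elements (elems F' - elems G') \<subseteq> maximal_elements (elems F - elems G)"
  using transposes_up_elems[OF assms] elems_upward[of _ F']
  unfolding maximal_elements_def by (auto 4 4 dest: less_imp_le)

lemma upper_regular_Fil:
  fixes F G :: "'a::{meet_continuous_lattice, modular_lattice} Fil"
  assumes "tame (F, G)"
    and bounded: "\<And>H K :: 'a Fil. H \<prec> K \<Longrightarrow> projectively_equivalent (H, K) (F, G) \<Longrightarrow>
           principally_bounded H K"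
  shows "upper_regular F G"
  unfolding upper_regular_def
proof (intro allI impI)
  fix I :: "('a Fil \<times> 'a Fil) set" and r and a b :: "'a Fil \<times> 'a Fil \<Rightarrow> 'a Fil"
  assume ne: "I \<noteq> {}" and lin: "strict_linear_order_on I r"
    and cov: "\<forall>i\<in>I. a i \<prec> b i \<and> projectively_equivalent (a i, b i) (F, G)"
    and up: "\<forall>i\<in>I. \<forall>j\<in>I. (i, j) \<in> r \<longrightarrow> (a i, b i) \<nearrow> (a j, b j)"
  let ?a = "SUP i\<in>I. a i" and ?b = "SUP i\<in>I. b i"
  have cmp: "i = j \<or> (i, j) \<in> r \<or> (j, i) \<in> r" if "i \<in> I" "j \<in> I" for i j
    using lin that by (auto simp: strict_linear_order_on_def total_on_def)
  have tame: "tame (a i, b i)" if "i \<in> I" for i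
    using tame_projectively_equivalent cov assms(1) that by blast
  define M where "M i = maximal_elements (elems (a i) - elems (b i))" for i
  define p where "p i = Inf (M i)" for i
  have p: "p i \<in> elems (a i) - elems (b i)" if i: "i \<in> I" for i
  proof -
    have "principal_filter (Fg (M i))"
      using bounded cov i unfolding principally_bounded_def M_def by blast
    moreover have sub: "M i \<subseteq> elems (a i) - elems (b i)"
      by (auto simp: M_def maximal_elements_def)
    ultimately have "p i \<in> elems (a i)"
      unfolding p_def using Inf_mem_of_principal_Fg by blast
    \<comment> \<open>Nonemptiness matters: the meet of an empty \<open>M i\<close> would be
      \<open>top\<close>, which is in \<open>b i\<close>.\<close>
    moreover obtain m where "m \<in> M i"
      using tame_maximal_elements_nonempty tame cov i unfolding M_def covered_by_def by blast
    then have "p i \<notin> elems (b i)"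
      using sub unfolding p_def by (meson DiffD2 Inf_lower elems_upward subsetD)
    ultimately show ?thesis
      by blast
  qed
  have mono: "p i \<le> p j" if "i \<in> I" "j \<in> I" "(i, j) \<in> r" for i j
    unfolding p_def M_def using maximal_elements_transposes_up up that
    by (blast intro: Inf_superset_mono)
  obtain i where i: "i \<in> I"
    using ne by blast
  \<comment> \<open>The tail from \<open>i\<close> on: there every \<open>p j\<close> lies in
    \<open>a i - b i\<close>, so \<open>tame_Sup_notin\<close> applies to the single pair
    \<open>(a i, b i)\<close>.\<close>
  define J where "J = {j \<in> I. j = i \<or> (i, j) \<in> r}"
  have J: "i \<in> J" "J \<subseteq> I"
    using i by (auto simp: J_def)
  let ?s = "SUP j\<in>J. p j"
  have "up_directed (p ` J)"
    unfolding up_directed_def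
  proof (intro conjI ballI)
    show "p ` J \<noteq> {}"
      using J by blast
  next
    fix u v assume "u \<in> p ` J" "v \<in> p ` J"
    then obtain j k where jk: "j \<in> J" "k \<in> J" "u = p j" "v = p k"
      by blast
    then have "j \<in> I" "k \<in> I"
      using J by auto
    then have "p j \<le> p k \<or> p k \<le> p j"
      using cmp[of j k] mono by blast
    then show "\<exists>w\<in>p ` J. u \<le> w \<and> v \<le> w"
      using jk by blast
  qed
  moreover have "p ` J \<subseteq> elems (a i) - elems (b i)"
  proof (rule image_subsetI)
    fix j assume "j \<in> J"
    then show "p j \<in> elems (a i) - elems (b i)"
      using p[of j] transposes_up_elems(2,3) up i unfolding J_def by blast
  qed
  ultimately have s_notin: "?s \<notin> elems (b i)"
    using tame_Sup_notin tame i by blast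
  have s_in_J: "?s \<in> elems (a j)" if "j \<in> J" for j
    using p[of j] J that by (meson DiffD1 SUP_upper elems_upward subsetD)
  have "?s \<in> elems (a j)" if j: "j \<in> I" for j
  proof (cases "j \<in> J")
    case True
    then show ?thesis
      by (rule s_in_J)
  next
    case False
    \<comment> \<open>For \<open>j\<close> before \<open>i\<close>, the filter \<open>a j\<close>
      contains \<open>a i\<close>, which already contains the join.\<close>
    then have "(a j, b j) \<nearrow> (a i, b i)"
      using cmp[OF i j] up i j by (auto simp: J_def)
    then show ?thesis
      using s_in_J[OF J(1)] transposes_up_elems(2) by blast
  qed
  then have "?s \<in> elems ?a - elems ?b"
    using s_notin i by (auto simp: elems_Sup)
  then have neq: "?a \<noteq> ?b"
    by auto
  have le: "a j \<le> b j" if "j \<in> I" for j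
    using cov that by (auto simp: covered_by_def)
  have sup: "sup (b i) ?a = ?b"
  proof (rule order.antisym)
    show "sup (b i) ?a \<le> ?b"
      using le i by (intro le_supI SUP_upper SUP_mono) auto
    have "elems (b i) \<inter> elems ?a \<subseteq> elems (b j)" if j: "j \<in> I" for j
    proof -
      have "elems ?a \<subseteq> elems (a j)"
        using j by (auto simp: elems_Sup)
      then show ?thesis
        using cmp[OF i j] up i j transposes_up_elems(3) by blast
    qed
    then show "?b \<le> sup (b i) ?a"
      by (auto simp: less_eq_Fil_def elems_sup elems_Sup)
  qed
  have "inf (b i) ?a = a i"
  proof -
    have "a i \<le> inf (b i) ?a" "inf (b i) ?a \<le> b i"
      using le i by (auto intro: SUP_upper)
    \<comment> \<open>The covering leaves only the endpoints \<open>a i\<close> and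
      \<open>b i\<close>; the latter would give \<open>b i \<le> ?a\<close>, hence
      \<open>?a = ?b\<close>.\<close>
    moreover have "inf (b i) ?a \<noteq> b i"
      using sup neq by (metis inf.absorb_iff1 sup.absorb2)
    ultimately show ?thesis
      using cov i unfolding covered_by_def by (metis order.not_eq_order_implies_strict)
  qed
  then have "(a i, b i) \<nearrow> (?a, ?b)"
    using sup le[OF i] unfolding transposes_up_def by (simp; metis sup_ge2)
  then show "?a \<prec> ?b"
    using transposes_up_covered_byD cov i by blast
qed

theorem theorem29:
  fixes F G :: "'a::{meet_continuous_lattice, modular_lattice} Fil"
  assumes "F \<prec> G"
    and "atomic_covering F G \<or> quasi_atomic_covering F G"
    and "\<And>H K :: 'a Fil. H \<prec> K \<Longrightarrow> projectively_equivalent (H, K) (F, G) \<Longrightarrow>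
           principally_bounded H K"
  shows "regular F G"
  unfolding regular_def
  using upper_regular_Fil[OF tame_atomic_or_quasi_atomic[OF assms(2)] assms(3)] lower_regular_Fil
  by blast

end
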